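(* Define a weight function on formulae by $\mathrm w(p)=\mathrm w(\bot)=1$, $\mathrm w(A\land B)=\mathrm w(A)+\mathrm w(B)+2$, $\mathrm w(A\lor B)=\mathrm w(A)+\mathrm w(B)+1$, $\mathrm w(A\to B)=\mathrm w(A)+\mathrm w(B)+1$, and let $\mu(\Pi)$ be the multiset of the weights of the formulae occurring in the block $\Pi$, a signed formula $\mathsf{T}A$ or $\mathsf{F}A$ contributing one occurrence of $\mathrm w(A)$. Then every rule of $\mathsf{BT}^{i}_{\downarrow}$ strictly decreases $\mu$ (from a block to each of its children) in the multiset ordering on finite multisets of natural numbers. Consequently no branch of a $\mathsf{BT}^{i}_{\downarrow}$ tableau is infinite, every $\mathsf{BT}^{i}_{\downarrow}$ tableau is finite, and exhaustive refutation search in $\mathsf{BT}^{i}_{\downarrow}$ terminates.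
   Context: Formulae are generated from a countable set of propositional variables by $A ::= p \mid \bot \mid A\land A \mid A\lor A \mid A\to A$. A signed formula is $\mathsf{T}A$ or $\mathsf{F}A$; a block is a finite set $\Pi$ of signed formulae; $\Pi^{\mathsf{T}}=\{\mathsf{T}A:\mathsf{T}A\in\Pi\}$. A block is simple if it contains exactly one $\mathsf{F}$-signed formula. The calculus $\mathsf{BT}^{i}_{\downarrow}$. Its blocks are simple. A block is closed if it contains $\mathsf{T}p$ and $\mathsf{F}p$ for some propositional variable $p$, or contains $\mathsf{T}\bot$; a closed block terminates its branch. The rules pass from a block (context $\Pi$ plus displayed principal formula, which is removed) to one or two children: - $\mathsf{T}\land$: from $\Pi,\mathsf{T}(A\land B)$ to $\Pi,\mathsf{T}A,\mathsf{T}B$. - $\mathsf{T}\lor$: from $\Pi,\mathsf{T}(A\lor B)$ to two children $\Pi,\mathsf{T}A$ and $\Pi,\mathsf{T}B$. - $\mathsf{F}\land$: from $\Pi,\mathsf{F}(A\land B)$ to two children $\Pi,\mathsf{F}A$ and $\Pi,\mathsf{F}B$. - $\mathsf{F}\lor_1$: from $\Pi,\mathsf{F}(A\lor B)$ to $\Pi,\mathsf{F}A$; $\mathsf{F}\lor_2$: from $\Pi,\mathsf{F}(A\lor B)$ to $\Pi,\mathsf{F}B$ (alternative rules). - $\mathsf{F}\to$: from $\Pi,\mathsf{F}(A\to B)$ to $\Pi^{\mathsf{T}},\mathsf{T}A,\mathsf{F}B$. - $\mathsf{T}\to_{\mathrm{at}}$: from $\Pi,\mathsf{T}p,\mathsf{T}(p\to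 B)$ to $\Pi,\mathsf{T}p,\mathsf{T}B$, with $p$ a propositional variable (the principal formula removed is $\mathsf{T}(p\to B)$; $\mathsf{T}p$ is retained). - $\mathsf{T}\to_{\land}$: from $\Pi,\mathsf{T}((A\land B)\to C)$ to $\Pi,\mathsf{T}(A\to(B\to C))$. - $\mathsf{T}\to_{\lor}$: from $\Pi,\mathsf{T}((A\lor B)\to C)$ to $\Pi,\mathsf{T}(A\to C),\mathsf{T}(B\to C)$. - $\mathsf{T}\to_{\to}$: from $\Pi,\mathsf{T}((A\to B)\to C)$ to two children $\Pi^{\mathsf{T}},\mathsf{T}(B\to C),\mathsf{F}(A\to B)$ and $\Pi,\mathsf{T}C$ (where $\Pi^{\mathsf{T}}$ is computed after removal of the principal formula). A tableau is a tree of blocks rooted at a simple block and grown by these rules (not assumed finite a priori). Exhaustive refutation search explores all tableaux for a given block. The multiset ordering is the Dershowitz–Manna ordering induced by $<$ on $\mathbb N$: $M'$ is smaller than $M$ if $M'=(M\setminus X)\cup Y$ for some non-empty $X\subseteq M$ and finite $Y$ such that every element of $Y$ is strictly smaller than some element of $X$. *)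

theory Defs
  imports "HOL-Library.Multiset_Order" "HOL-Library.Countable"
begin

datatype 'a form =
    Var 'a
  | Bot
  | Con "'a form" "'a form"
  | Dis "'a form" "'a form"
  | Imp "'a form" "'a form"

datatype 'a sform =
    T (formula: "'a form")
  | F (formula: "'a form")

text \<open>Blocks are finite; finiteness is imposed by \<open>simple_block\<close>, not by the type.\<close>

type_synonym 'a block = "'a sform set"

definition T_part :: "'a block \<Rightarrow> 'a block" where
  "T_part \<Pi> = {X \<in> \<Pi>. \<exists>A. X = T A}"

definition simple_block :: "'a block \<Rightarrow> bool" where
  "simple_block \<Pi> \<longleftrightarrow> finite \<Pi> \<and> (\<exists>!A. F A \<in> \<Pi>)"

definition closed_block :: "'a block \<Rightarrow> bool" where
  "closed_block \<Pi> \<longleftrightarrow> (\<exists>p. T (Var p) \<in> \<Pi> \<and> F (Var p) \<in> \<Pi>) \<or> T Bot \<in> \<Pi>"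

text \<open>
  \<open>bt_rule \<Gamma> \<Delta>s\<close>: some rule instance leads from the block \<open>\<Gamma>\<close> to the list \<open>\<Delta>s\<close> of children.
  Here \<open>\<Gamma>\<close> is the whole parent block, so the context of a principal formula \<open>X \<in> \<Gamma>\<close> is
  \<open>\<Gamma> - {X}\<close>.
\<close>

inductive bt_rule :: "'a block \<Rightarrow> 'a block list \<Rightarrow> bool" where
  T_Con: "T (Con A B) \<in> \<Gamma> \<Longrightarrow>
    bt_rule \<Gamma> [(\<Gamma> - {T (Con A B)}) \<union> {T A, T B}]"
| T_Dis: "T (Dis A B) \<in> \<Gamma> \<Longrightarrow>
    bt_rule \<Gamma> [(\<Gamma> - {T (Dis A B)}) \<union> {T A}, (\<Gamma> - {T (Dis A B)}) \<union> {T B}]"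
| F_Con: "F (Con A B) \<in> \<Gamma> \<Longrightarrow>
    bt_rule \<Gamma> [(\<Gamma> - {F (Con A B)}) \<union> {F A}, (\<Gamma> - {F (Con A B)}) \<union> {F B}]"
| F_Dis1: "F (Dis A B) \<in> \<Gamma> \<Longrightarrow>
    bt_rule \<Gamma> [(\<Gamma> - {F (Dis A B)}) \<union> {F A}]"
| F_Dis2: "F (Dis A B) \<in> \<Gamma> \<Longrightarrow>
    bt_rule \<Gamma> [(\<Gamma> - {F (Dis A B)}) \<union> {F B}]"
| F_Imp: "F (Imp A B) \<in> \<Gamma> \<Longrightarrow>
    bt_rule \<Gamma> [T_part (\<Gamma> - {F (Imp A B)}) \<union> {T A, F B}]"
| T_Imp_at: "T (Var p) \<in> \<Gamma> \<Longrightarrow> T (Imp (Var p) B) \<in> \<Gamma> \<Longrightarrow>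
    bt_rule \<Gamma> [(\<Gamma> - {T (Imp (Var p) B)}) \<union> {T B}]"
| T_Imp_Con: "T (Imp (Con A B) C) \<in> \<Gamma> \<Longrightarrow>
    bt_rule \<Gamma> [(\<Gamma> - {T (Imp (Con A B) C)}) \<union> {T (Imp A (Imp B C))}]"
| T_Imp_Dis: "T (Imp (Dis A B) C) \<in> \<Gamma> \<Longrightarrow>
    bt_rule \<Gamma> [(\<Gamma> - {T (Imp (Dis A B) C)}) \<union> {T (Imp A C), T (Imp B C)}]"
| T_Imp_Imp: "T (Imp (Imp A B) C) \<in> \<Gamma> \<Longrightarrow>
    bt_rule \<Gamma>
      [T_part (\<Gamma> - {T (Imp (Imp A B) C)}) \<union> {T (Imp B C), F (Imp A B)},
       (\<Gamma> - {T (Imp (Imp A B) C)}) \<union> {T C}]"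

text \<open>A codatatype, so that a tableau may a priori have infinite branches.\<close>

codatatype 'b tree = Node (root: 'b) (children: "'b tree list")

text \<open>
  A tableau need not be fully expanded: any block may label a leaf. The rules are applied to
  open blocks only, since a closed block terminates its branch.
\<close>

coinductive grown :: "'a block tree \<Rightarrow> bool" where
  leaf: "grown (Node \<Gamma> [])"
| step: "\<not> closed_block \<Gamma> \<Longrightarrow> bt_rule \<Gamma> (map root ts) \<Longrightarrow> \<forall>t \<in> set ts. grown t \<Longrightarrow>
    grown (Node \<Gamma> ts)"

definition tableau :: "'a block tree \<Rightarrow> bool" where
  "tableau t \<longleftrightarrow> simple_block (root t) \<and> grown t"

text \<open>Nodes are addressed by the finite sequence of child indices leading to them from the root.\<close>

primrec is_position :: "nat list \<Rightarrow> 'b tree \<Rightarrow> bool" where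
  "is_position [] t \<longleftrightarrow> True"
| "is_position (i # ps) t \<longleftrightarrow> i < length (children t) \<and> is_position ps (children t ! i)"

definition positions :: "'b tree \<Rightarrow> nat list set" where
  "positions t = {ps. is_position ps t}"

definition finite_tree :: "'b tree \<Rightarrow> bool" where
  "finite_tree t \<longleftrightarrow> finite (positions t)"

text \<open>An infinite branch is given by the child index \<open>f n\<close> it chooses at each depth \<open>n\<close>.\<close>

definition infinite_branch :: "'b tree \<Rightarrow> (nat \<Rightarrow> nat) \<Rightarrow> bool" where
  "infinite_branch t f \<longleftrightarrow> (\<forall>n. map f [0..<n] \<in> positions t)"

definition tableaux_for :: "'a block \<Rightarrow> 'a block tree set" where
  "tableaux_for \<Pi> = {t. tableau t \<and> root t = \<Pi>}"

inductive expands :: "'a block tree \<Rightarrow> 'a block tree \<Rightarrow> bool" where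
  here: "\<not> closed_block \<Gamma> \<Longrightarrow> bt_rule \<Gamma> \<Delta>s \<Longrightarrow>
    expands (Node \<Gamma> []) (Node \<Gamma> (map (\<lambda>\<Delta>. Node \<Delta> []) \<Delta>s))"
| below: "expands t t' \<Longrightarrow> expands (Node \<Gamma> (ts @ t # us)) (Node \<Gamma> (ts @ t' # us))"

text \<open>The tableaux found after \<open>n\<close> rounds of trying every possible search step.\<close>

primrec explored :: "'a block \<Rightarrow> nat \<Rightarrow> 'a block tree set" where
  "explored \<Pi> 0 = {Node \<Pi> []}"
| "explored \<Pi> (Suc n) = explored \<Pi> n \<union> {t'. \<exists>t \<in> explored \<Pi> n. expands t t'}"

text \<open>
  After finitely many rounds, each over finitely many tableaux, the search finds nothing new,
  and it has then explored all tableaux for the block.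
\<close>

definition exhaustive_search_terminates :: "'a block \<Rightarrow> bool" where
  "exhaustive_search_terminates \<Pi> \<longleftrightarrow>
    (\<forall>n. finite (explored \<Pi> n)) \<and>
    (\<exists>n. explored \<Pi> (Suc n) = explored \<Pi> n \<and> explored \<Pi> n = tableaux_for \<Pi>)"

primrec weight :: "'a form \<Rightarrow> nat" where
  "weight (Var p) = 1"
| "weight Bot = 1"
| "weight (Con A B) = weight A + weight B + 2"
| "weight (Dis A B) = weight A + weight B + 1"
| "weight (Imp A B) = weight A + weight B + 1"

definition \<mu> :: "'a block \<Rightarrow> nat multiset" where
  "\<mu> \<Pi> = image_mset (\<lambda>X. weight (formula X)) (mset_set \<Pi>)"

text \<open>
  The multiset ordering is \<open>multp\<^sub>D\<^sub>M (<)\<close>, the library's literal form of the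
  Dershowitz--Manna definition.
\<close>

end

theory Submission
  imports Defs
begin

text \<open>
  Every rule removes its principal formula \<open>X\<close> from the block and adds formulae out of a finite set,
  depending on \<open>X\<close> only, each lighter than \<open>X\<close>; context formulae are kept or dropped
  (\<open>bt_rule_child\<close>, \<open>weight_components\<close>). This is a Dershowitz--Manna step: replace the
  multiset of lost formulae, which contains \<open>X\<close>, by the multiset of gained ones
  (\<open>bt_rule_decreases_\<mu>\<close>). Blocks being sets, an added formula may coincide with one of the context;
  this only makes the child smaller, and comparing the lost formulae \<open>\<Gamma> - \<Delta>\<close> with the gained
  formulae \<open>\<Delta> - \<Gamma>\<close> takes care of it.

  The multiset ordering is well-founded, so properties of tableaux can be proved by induction as if
  tableaux were inductively generated, although the type of trees admits infinite branches
  (\<open>grown_induct\<close>). As a node has finitely many children, this induction yields finiteness of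
  each tableau, and with it the absence of infinite branches. It also shows that each tableau is
  obtained from the one-node tableau by finitely many expansion steps
  (\<open>expands_reaches_grown\<close>).

  For the search, a finite block has only finitely many rule instances, since a rule has at most two
  children and these are subsets of a fixed finite set. Well-founded induction then gives that there
  are only finitely many tableaux for a block (\<open>finite_grown_root\<close>). A search that collects more and
  more of these finitely many tableaux and eventually reaches each of them has, at some
  round, collected all of them.
\<close>

section \<open>Rules decrease the measure\<close>

text \<open>
  The formulae that some rule may add when \<open>X\<close> is principal. The alternative rules for a principal
  formula and all their children are lumped together, as only finiteness and weight matter.
\<close>

fun components :: "'a sform \<Rightarrow> 'a sform set" where
  "components (T (Con A B)) = {T A, T B}"
| "components (T (Dis A B)) = {T A, T B}"
| "components (F (Con A B)) = {F A, F B}"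
| "components (F (Dis A B)) = {F A, F B}"
| "components (F (Imp A B)) = {T A, F B}"
| "components (T (Imp (Var p) B)) = {T B}"
| "components (T (Imp (Con A B) C)) = {T (Imp A (Imp B C))}"
| "components (T (Imp (Dis A B) C)) = {T (Imp A C), T (Imp B C)}"
| "components (T (Imp (Imp A B) C)) = {T (Imp B C), F (Imp A B), T C}"
| "components X = {}"

lemma finite_components: "finite (components X)"
  by (cases X rule: components.cases) auto

text \<open>
  All components but one have fewer connectives than \<open>X\<close> and no more atoms. For
  \<open>Imp (Con A B) C\<close> the component \<open>Imp A (Imp B C)\<close> has as many connectives as \<open>X\<close>; this is why
  a conjunction counts 2 and not 1.
\<close>

lemma weight_components: "Y \<in> components X \<Longrightarrow> weight (formula Y) < weight (formula X)"
  by (cases X rule: components.cases) auto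

text \<open>
  What well-foundedness needs to know about the individual rules. The principal formula does not
  come back as one of the added formulae because the formulae added are lighter, hence different from it.
\<close>

lemma bt_rule_child:
  assumes "bt_rule \<Gamma> \<Delta>s" and "\<Delta> \<in> set \<Delta>s"
  shows "\<exists>X\<in>\<Gamma>. X \<notin> \<Delta> \<and> \<Delta> \<subseteq> \<Gamma> \<union> components X"
proof -
  have "\<exists>X\<in>\<Gamma>. \<Delta> \<subseteq> (\<Gamma> - {X}) \<union> components X"
    using assms by (induction rule: bt_rule.induct) (force simp: T_part_def)+
  moreover have "X \<notin> components X" for X :: "'a sform"
    using weight_components by blast
  ultimately show ?thesis
    by blast
qed

lemma length_bt_rule: "bt_rule \<Gamma> \<Delta>s \<Longrightarrow> length \<Delta>s \<le> 2"
  by (induction rule: bt_rule.induct) auto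

lemma finite_bt_rule_child:
  assumes "bt_rule \<Gamma> \<Delta>s" and "\<Delta> \<in> set \<Delta>s" and "finite \<Gamma>"
  shows "finite \<Delta>"
  using bt_rule_child[OF assms(1,2)] assms(3) finite_components
  by (meson finite_UnI finite_subset)

theorem bt_rule_decreases_\<mu>:
  assumes "bt_rule \<Gamma> \<Delta>s" and "\<Delta> \<in> set \<Delta>s" and "finite \<Gamma>"
  shows "multp\<^sub>D\<^sub>M (<) (\<mu> \<Delta>) (\<mu> \<Gamma>)"
proof -
  obtain X where X: "X \<in> \<Gamma>" "X \<notin> \<Delta>" "\<Delta> \<subseteq> \<Gamma> \<union> components X"
    using bt_rule_child[OF assms(1,2)] by blast
  have fin: "finite \<Delta>"
    using finite_bt_rule_child[OF assms] .
  let ?w = "\<lambda>X. weight (formula X)"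
  have \<mu>_split: "\<mu> A = \<mu> (A - B) + \<mu> (A \<inter> B)" if "finite A" for A B :: "'a block"
  proof -
    have "mset_set A = mset_set (A - B) + mset_set (A \<inter> B)"
      using that by (subst mset_set_Union[symmetric]) (auto simp: Un_Diff_Int)
    then show ?thesis
      by (simp add: \<mu>_def)
  qed
  have \<Gamma>: "\<mu> \<Gamma> = \<mu> (\<Gamma> - \<Delta>) + \<mu> (\<Gamma> \<inter> \<Delta>)" and \<Delta>: "\<mu> \<Delta> = \<mu> (\<Delta> - \<Gamma>) + \<mu> (\<Gamma> \<inter> \<Delta>)"
    using \<mu>_split[of \<Gamma> \<Delta>] \<mu>_split[of \<Delta> \<Gamma>] assms(3) fin by (simp_all add: Int_commute)
  have lost: "?w X \<in># \<mu> (\<Gamma> - \<Delta>)"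
    using X assms(3) by (auto simp: \<mu>_def)
  have "k < ?w X" if "k \<in># \<mu> (\<Delta> - \<Gamma>)" for k
    using that X fin weight_components by (auto simp: \<mu>_def)
  moreover have "\<mu> (\<Gamma> - \<Delta>) \<noteq> {#}"
    using lost by auto
  ultimately show ?thesis
    unfolding multp\<^sub>D\<^sub>M_def
    using lost \<Gamma> \<Delta> by (intro exI[of _ "\<mu> (\<Gamma> - \<Delta>)"] exI[of _ "\<mu> (\<Delta> - \<Gamma>)"]) auto
qed

section \<open>Well-founded induction on blocks and tableaux\<close>

lemma finite_block_induct [consumes 1, case_names rules]:
  assumes "finite \<Gamma>"
    and step: "\<And>\<Gamma>. finite \<Gamma> \<Longrightarrow>
      (\<And>\<Delta>s \<Delta>. bt_rule \<Gamma> \<Delta>s \<Longrightarrow> \<Delta> \<in> set \<Delta>s \<Longrightarrow> P \<Delta>) \<Longrightarrow> P \<Gamma>"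
  shows "P \<Gamma>"
proof -
  have "wfp (multp\<^sub>D\<^sub>M ((<) :: nat \<Rightarrow> nat \<Rightarrow> bool))"
    using wfp_multp[of "(<) :: nat \<Rightarrow> nat \<Rightarrow> bool"]
    by (simp add: multp_eq_multp\<^sub>D\<^sub>M wfp_on_less)
  then have "finite \<Gamma> \<longrightarrow> P \<Gamma>" if "M = \<mu> \<Gamma>" for M \<Gamma>
    using that
  proof (induction M arbitrary: \<Gamma> rule: wfp_induct_rule)
    case (less M)
    show ?case
    proof
      assume fin: "finite \<Gamma>"
      show "P \<Gamma>"
      proof (rule step[OF fin])
        fix \<Delta>s \<Delta>
        assume rule: "bt_rule \<Gamma> \<Delta>s" "\<Delta> \<in> set \<Delta>s"
        have "multp\<^sub>D\<^sub>M (<) (\<mu> \<Delta>) M"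
          using bt_rule_decreases_\<mu>[OF rule fin] less.prems by simp
        then show "P \<Delta>"
          using less.IH finite_bt_rule_child[OF rule fin] by simp
      qed
    qed
  qed
  then show ?thesis
    using assms(1) by blast
qed

text \<open>
  Although \<open>grown\<close> is defined coinductively, a tableau over finite blocks obeys the induction
  principle of the corresponding inductive definition, because the blocks decrease along branches.
\<close>

lemma grown_induct [consumes 2, case_names leaf step]:
  assumes "finite (root t)" and "grown t"
    and leaf: "\<And>\<Gamma>. P (Node \<Gamma> [])"
    and step: "\<And>\<Gamma> ts. \<not> closed_block \<Gamma> \<Longrightarrow> bt_rule \<Gamma> (map root ts) \<Longrightarrow>
      (\<And>t. t \<in> set ts \<Longrightarrow> P t) \<Longrightarrow> P (Node \<Gamma> ts)"
  shows "P t"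
proof -
  have "\<forall>t. root t = \<Gamma> \<longrightarrow> grown t \<longrightarrow> P t" if "finite \<Gamma>" for \<Gamma>
    using that
  proof (induction \<Gamma> rule: finite_block_induct)
    case (rules \<Gamma>)
    show ?case
    proof (intro allI impI)
      fix t assume "root t = \<Gamma>" and "grown t"
      from this(2) show "P t"
      proof cases
        case (step \<Gamma>' ts)
        then show ?thesis
          using rules.IH \<open>root t = \<Gamma>\<close> by (force intro!: assms(4))
      qed (use leaf in simp)
    qed
  qed
  then show ?thesis
    using assms(1,2) by blast
qed

section \<open>Finiteness of tableaux\<close>

lemma positions_Node:
  "positions (Node \<Gamma> ts) = insert [] (\<Union>i<length ts. (#) i ` positions (ts ! i))"
proof (rule set_eqI)
  show "ps \<in> positions (Node \<Gamma> ts) \<longleftrightarrow>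
    ps \<in> insert [] (\<Union>i<length ts. (#) i ` positions (ts ! i))" for ps
    by (cases ps) (auto simp: positions_def)
qed

lemma finite_tree_grown:
  assumes "finite (root t)" and "grown t"
  shows "finite_tree t"
  using assms
  by (induction t rule: grown_induct) (auto simp: finite_tree_def positions_Node)

lemma finite_tree_no_infinite_branch:
  assumes "finite_tree t"
  shows "\<not> infinite_branch t f"
proof
  assume "infinite_branch t f"
  then have "range (\<lambda>n. map f [0..<n]) \<subseteq> positions t"
    by (auto simp: infinite_branch_def)
  then have "finite (range (\<lambda>n. map f [0..<n]))"
    using assms finite_subset unfolding finite_tree_def by blast
  moreover have "inj (\<lambda>n. map f [0..<n])"
    by (rule injI) (metis length_map length_upt diff_zero)
  ultimately show False
    using finite_imageD by blast
qed

section \<open>Finitely many tableaux for a block\<close>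

lemma finite_bt_rule_instances:
  assumes "finite \<Gamma>"
  shows "finite {\<Delta>s. bt_rule \<Gamma> \<Delta>s}"
proof -
  let ?B = "Pow (\<Gamma> \<union> (\<Union>X\<in>\<Gamma>. components X))"
  have "\<Delta> \<in> ?B" if "bt_rule \<Gamma> \<Delta>s" and "\<Delta> \<in> set \<Delta>s" for \<Delta>s \<Delta>
    using bt_rule_child[OF that] by blast
  then have "{\<Delta>s. bt_rule \<Gamma> \<Delta>s} \<subseteq> {\<Delta>s. set \<Delta>s \<subseteq> ?B \<and> length \<Delta>s \<le> 2}"
    by (simp add: subset_iff length_bt_rule)
  moreover have "finite ?B"
    using assms finite_components by blast
  ultimately show ?thesis
    by (rule finite_subset[OF _ finite_lists_length_le])
qed

lemma finite_grown_root:
  assumes "finite \<Gamma>"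
  shows "finite {t. grown t \<and> root t = \<Gamma>}"
  using assms
proof (induction \<Gamma> rule: finite_block_induct)
  case (rules \<Gamma>)
  let ?G = "\<lambda>\<Delta>. {t. grown t \<and> root t = \<Delta>}"
  \<comment> \<open>A superset of the possible lists of subtrees; which subtree belongs to which child of \<open>\<Gamma>\<close> is
    forgotten, since finiteness is all that is wanted.\<close>
  let ?L = "\<lambda>\<Delta>s. {ts. set ts \<subseteq> (\<Union>\<Delta>\<in>set \<Delta>s. ?G \<Delta>) \<and> length ts = length \<Delta>s}"
  have "t \<in> insert (Node \<Gamma> []) (\<Union>\<Delta>s\<in>{\<Delta>s. bt_rule \<Gamma> \<Delta>s}. Node \<Gamma> ` ?L \<Delta>s)"
    if "grown t" and "root t = \<Gamma>" for t
    using that(1)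
  proof cases
    case (step \<Gamma>' ts)
    then have "ts \<in> ?L (map root ts)"
      by auto
    with step that(2) show ?thesis
      by auto
  qed (use that in simp)
  then have "?G \<Gamma> \<subseteq> insert (Node \<Gamma> []) (\<Union>\<Delta>s\<in>{\<Delta>s. bt_rule \<Gamma> \<Delta>s}. Node \<Gamma> ` ?L \<Delta>s)"
    by blast
  moreover have "finite (?L \<Delta>s)" if "bt_rule \<Gamma> \<Delta>s" for \<Delta>s
    using rules.IH[OF that] by (intro finite_lists_length_eq) blast
  ultimately show ?case
    using finite_bt_rule_instances[OF rules.hyps] by (elim finite_subset) blast
qed

section \<open>The search reaches exactly the tableaux\<close>

lemma expands_root: "expands t t' \<Longrightarrow> root t' = root t"
  by (induction rule: expands.induct) auto

lemma expands_grown: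
  assumes "expands t t'" and "grown t"
  shows "grown t'"
  using assms
proof (induction rule: expands.induct)
  case (here \<Gamma> \<Delta>s)
  have "map root (map (\<lambda>\<Delta>. Node \<Delta> []) \<Delta>s) = \<Delta>s"
    by (simp add: comp_def)
  with here show ?case
    by (intro grown.step) (auto intro: grown.leaf)
next
  case (below t t' \<Gamma> ts us)
  from below.prems show ?case
  proof cases
    case step
    with below.IH expands_root[OF below.hyps] show ?thesis
      by (intro grown.step) auto
  qed auto
qed

text \<open>Subtrees that are siblings are expanded independently, here from left to right.\<close>

lemma expands_children:
  assumes "list_all2 expands\<^sup>*\<^sup>* ss ts"
  shows "expands\<^sup>*\<^sup>* (Node \<Gamma> (us @ ss)) (Node \<Gamma> (us @ ts))"
  using assms
proof (induction arbitrary: us rule: list_all2_induct)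
  case Nil
  show ?case by simp
next
  case (Cons s ss t ts)
  have "expands\<^sup>*\<^sup>* (Node \<Gamma> (us @ s # ss)) (Node \<Gamma> (us @ t # ss))"
    using Cons.hyps(1)
    by (induction rule: rtranclp_induct) (auto intro: expands.below rtranclp.rtrancl_into_rtrancl)
  also have "expands\<^sup>*\<^sup>* (Node \<Gamma> (us @ t # ss)) (Node \<Gamma> (us @ t # ts))"
    using Cons.IH[of "us @ [t]"] by simp
  finally show ?case .
qed

text \<open>
  The search extends leaves only, so a given tableau is rebuilt from the root: the rule at the root is
  applied first, and then the subtrees are grown at the new leaves.
\<close>

lemma expands_reaches_grown:
  assumes "finite (root t)" and "grown t"
  shows "expands\<^sup>*\<^sup>* (Node (root t) []) t"
  using assms
proof (induction t rule: grown_induct)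
  case (step \<Gamma> ts)
  let ?leaves = "map (\<lambda>\<Delta>. Node \<Delta> []) (map root ts)"
  have "expands (Node \<Gamma> []) (Node \<Gamma> ?leaves)"
    using step.hyps by (rule expands.here)
  moreover have "list_all2 expands\<^sup>*\<^sup>* ?leaves ts"
    using step.IH by (auto simp: list_all2_conv_all_nth)
  then have "expands\<^sup>*\<^sup>* (Node \<Gamma> ?leaves) (Node \<Gamma> ts)"
    using expands_children[of ?leaves ts \<Gamma> "[]"] by simp
  ultimately show ?case
    by (simp add: converse_rtranclp_into_rtranclp)
qed simp

lemma expands_reaches_explored:
  assumes "expands\<^sup>*\<^sup>* (Node \<Pi> []) t"
  shows "\<exists>n. t \<in> explored \<Pi> n"
  using assms
proof (induction rule: rtranclp_induct)
  case base
  have "Node \<Pi> [] \<in> explored \<Pi> 0"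
    by simp
  then show ?case ..
next
  case (step t t')
  then obtain n where "t \<in> explored \<Pi> n"
    by blast
  with step.hyps have "t' \<in> explored \<Pi> (Suc n)"
    by auto
  then show ?case ..
qed

lemma explored_subset_tableaux_for:
  assumes "simple_block \<Pi>"
  shows "explored \<Pi> n \<subseteq> tableaux_for \<Pi>"
proof (induction n)
  case 0
  show ?case
    using assms by (auto simp: tableaux_for_def tableau_def intro: grown.leaf)
next
  case (Suc n)
  have "t' \<in> tableaux_for \<Pi>" if "t \<in> explored \<Pi> n" and "expands t t'" for t t'
    using that Suc expands_root[OF that(2)] expands_grown[OF that(2)]
    by (auto simp: tableaux_for_def tableau_def)
  with Suc show ?case
    by auto
qed

lemma exhaustive_search_terminates_simple:
  assumes "simple_block \<Pi>"
  shows "exhaustive_search_terminates \<Pi>"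
proof -
  have fin\<Pi>: "finite \<Pi>"
    using assms by (simp add: simple_block_def)
  have fin: "finite (tableaux_for \<Pi>)"
    by (rule finite_subset[OF _ finite_grown_root[OF fin\<Pi>]])
      (auto simp: tableaux_for_def tableau_def)
  have sub: "explored \<Pi> n \<subseteq> tableaux_for \<Pi>" for n
    using explored_subset_tableaux_for[OF assms] .
  have mono: "mono (explored \<Pi>)"
    by (rule mono_iff_le_Suc[THEN iffD2]) simp
  have "\<exists>n. t \<in> explored \<Pi> n" if "t \<in> tableaux_for \<Pi>" for t
    using that fin\<Pi> expands_reaches_grown expands_reaches_explored
    unfolding tableaux_for_def tableau_def by fastforce
  then obtain r where r: "t \<in> explored \<Pi> (r t)" if "t \<in> tableaux_for \<Pi>" for t
    by metis
  \<comment> \<open>The round by which the last of the finitely many tableaux has been found.\<close>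
  define N where "N = Max (r ` tableaux_for \<Pi>)"
  have "explored \<Pi> N = tableaux_for \<Pi>"
  proof (intro equalityI subsetI)
    fix t assume t: "t \<in> tableaux_for \<Pi>"
    then have "r t \<le> N"
      using fin by (simp add: N_def)
    with r[OF t] show "t \<in> explored \<Pi> N"
      using mono monoD by blast
  qed (use sub in blast)
  moreover from this have "explored \<Pi> (Suc N) = explored \<Pi> N"
    using sub[of "Suc N"] by auto
  ultimately show ?thesis
    unfolding exhaustive_search_terminates_def
    using finite_subset[OF sub fin] by blast
qed

section \<open>Termination\<close>

theorem theorem7p3:
  shows "(\<forall>(\<Pi> :: 'a::countable block) \<Delta>s. simple_block \<Pi> \<longrightarrow> bt_rule \<Pi> \<Delta>s \<longrightarrow>
            (\<forall>\<Delta> \<in> set \<Delta>s. multp\<^sub>D\<^sub>M (<) (\<mu> \<Delta>) (\<mu> \<Pi>)))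
       \<and> (\<forall>t :: 'a block tree. tableau t \<longrightarrow> \<not> (\<exists>f. infinite_branch t f))
       \<and> (\<forall>t :: 'a block tree. tableau t \<longrightarrow> finite_tree t)
       \<and> (\<forall>\<Pi> :: 'a block. simple_block \<Pi> \<longrightarrow> exhaustive_search_terminates \<Pi>)"
proof (intro conjI allI impI ballI)
  show "multp\<^sub>D\<^sub>M (<) (\<mu> \<Delta>) (\<mu> \<Pi>)"
    if "simple_block \<Pi>" and "bt_rule \<Pi> \<Delta>s" and "\<Delta> \<in> set \<Delta>s" for \<Pi> \<Delta> :: "'a block" and \<Delta>s
    using that bt_rule_decreases_\<mu> unfolding simple_block_def by blast
  show fin: "finite_tree t" if "tableau t" for t :: "'a block tree"
    using that finite_tree_grown unfolding tableau_def simple_block_def by blast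
  show "\<not> (\<exists>f. infinite_branch t f)" if "tableau t" for t :: "'a block tree"
    using finite_tree_no_infinite_branch fin[OF that] by blast
  show "exhaustive_search_terminates \<Pi>" if "simple_block \<Pi>" for \<Pi> :: "'a block"
    using that by (rule exhaustive_search_terminates_simple)
qed

end
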